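(* Let $\mathcal S, \mathcal T$ be additive categories. Let $R: \mathcal T \to \mathcal S$ be a functor admitting a left adjoint $L:\mathcal S \to \mathcal T$. Let $\varepsilon: LR \to 1_{\mathcal T}$ and $\eta: 1_{\mathcal S}\to RL$ be the counit and unit of the adjunction, respectively. Then the following are true: (1) If there exist objects $M$ in $\mathcal S$ and $N$ in $\mathcal T$ such that $M\in \operatorname{add}(R(N))$, then the natural map $\eta_M: M \to RL(M)$ is a split monomorphism. (2) If there exist objects $M$ in $\mathcal S$ and $N$ in $\mathcal T$ such that $N\in \operatorname{add}(L(M))$, then the natural map $\varepsilon_N: LR(N) \to N$ is a split epimorphism.
   Context: For an additive category $\mathcal C$ and an object $C$ of $\mathcal C$, $\operatorname{add}(C)$ denotes the smallest (full) subcategory of $\mathcal C$ that contains $C$ and is closed under finite direct sums and direct summands (retracts); i.e. its objects are the retracts of finite direct sums of copies of $C$. A split monomorphism is a morphism admitting a left inverse; a split epimorphism is a morphism admitting a right inverse. *)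

theory Defs
  imports "HOL-Algebra.FiniteProduct"
begin

record ('o, 'm) category =
  Obj :: "'o set"
  Arr :: "'m set"
  Dom :: "'m \<Rightarrow> 'o"
  Cod :: "'m \<Rightarrow> 'o"
  Id :: "'o \<Rightarrow> 'm"
  Comp :: "'m \<Rightarrow> 'm \<Rightarrow> 'm"  (infixl "\<cdot>\<index>" 70)

definition Hom :: "('o, 'm, 'z) category_scheme \<Rightarrow> 'o \<Rightarrow> 'o \<Rightarrow> 'm set"
  where "Hom C A B = {f \<in> Arr C. Dom C f = A \<and> Cod C f = B}"

locale category =
  fixes C :: "('o, 'm, 'z) category_scheme" (structure)
  assumes Dom_in_Obj: "f \<in> Arr C \<Longrightarrow> Dom C f \<in> Obj C"
    and Cod_in_Obj: "f \<in> Arr C \<Longrightarrow> Cod C f \<in> Obj C"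
    and Id_in_Hom: "A \<in> Obj C \<Longrightarrow> Id C A \<in> Hom C A A"
    and Comp_in_Hom: "f \<in> Hom C A B \<Longrightarrow> g \<in> Hom C B D \<Longrightarrow> g \<cdot> f \<in> Hom C A D"
    and Comp_Id: "f \<in> Hom C A B \<Longrightarrow> f \<cdot> Id C A = f"
    and Id_Comp: "f \<in> Hom C A B \<Longrightarrow> Id C B \<cdot> f = f"
    and Comp_assoc: "f \<in> Hom C A B \<Longrightarrow> g \<in> Hom C B D \<Longrightarrow> h \<in> Hom C D E \<Longrightarrow>
      (h \<cdot> g) \<cdot> f = h \<cdot> (g \<cdot> f)"

definition split_mono :: "('o, 'm, 'z) category_scheme \<Rightarrow> 'm \<Rightarrow> bool"
  where "split_mono C f \<longleftrightarrow> f \<in> Arr C \<and>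
    (\<exists>g \<in> Hom C (Cod C f) (Dom C f). g \<cdot>\<^bsub>C\<^esub> f = Id C (Dom C f))"

definition split_epi :: "('o, 'm, 'z) category_scheme \<Rightarrow> 'm \<Rightarrow> bool"
  where "split_epi C f \<longleftrightarrow> f \<in> Arr C \<and>
    (\<exists>g \<in> Hom C (Cod C f) (Dom C f). f \<cdot>\<^bsub>C\<^esub> g = Id C (Cod C f))"

definition is_retract :: "('o, 'm, 'z) category_scheme \<Rightarrow> 'o \<Rightarrow> 'o \<Rightarrow> bool"
  where "is_retract C A X \<longleftrightarrow> A \<in> Obj C \<and> X \<in> Obj C \<and>
    (\<exists>i \<in> Hom C A X. \<exists>p \<in> Hom C X A. p \<cdot>\<^bsub>C\<^esub> i = Id C A)"

record ('o, 'm, 'p, 'n) fctor =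
  OMap :: "'o \<Rightarrow> 'p"
  AMap :: "'m \<Rightarrow> 'n"

definition id_fctor :: "('o, 'm, 'o, 'm) fctor"
  where "id_fctor = \<lparr>OMap = (\<lambda>A. A), AMap = (\<lambda>f. f)\<rparr>"

definition comp_fctor ::
  "('p, 'n, 'q, 'k) fctor \<Rightarrow> ('o, 'm, 'p, 'n) fctor \<Rightarrow> ('o, 'm, 'q, 'k) fctor"
  where "comp_fctor G F = \<lparr>OMap = OMap G \<circ> OMap F, AMap = AMap G \<circ> AMap F\<rparr>"

locale is_functor = dom: category C + cod: category D
  for C :: "('o, 'm, 'z) category_scheme" and D :: "('p, 'n, 'w) category_scheme" +
  fixes F :: "('o, 'm, 'p, 'n) fctor"
  assumes OMap_in_Obj: "A \<in> Obj C \<Longrightarrow> OMap F A \<in> Obj D"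
    and AMap_in_Hom: "f \<in> Hom C A B \<Longrightarrow> AMap F f \<in> Hom D (OMap F A) (OMap F B)"
    and AMap_Id: "A \<in> Obj C \<Longrightarrow> AMap F (Id C A) = Id D (OMap F A)"
    and AMap_Comp: "f \<in> Hom C A B \<Longrightarrow> g \<in> Hom C B E \<Longrightarrow>
      AMap F (g \<cdot>\<^bsub>C\<^esub> f) = AMap F g \<cdot>\<^bsub>D\<^esub> AMap F f"

locale nat_trans = src: is_functor C D F + tgt: is_functor C D G
  for C :: "('o, 'm, 'z) category_scheme" and D :: "('p, 'n, 'w) category_scheme"
    and F :: "('o, 'm, 'p, 'n) fctor" and G :: "('o, 'm, 'p, 'n) fctor" +
  fixes \<tau> :: "'o \<Rightarrow> 'n"
  assumes component: "A \<in> Obj C \<Longrightarrow> \<tau> A \<in> Hom D (OMap F A) (OMap G A)"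
    and naturality: "f \<in> Hom C A B \<Longrightarrow> \<tau> B \<cdot>\<^bsub>D\<^esub> AMap F f = AMap G f \<cdot>\<^bsub>D\<^esub> \<tau> A"

text \<open>\<open>L : S \<rightarrow> T\<close> is left adjoint to \<open>R : T \<rightarrow> S\<close>, with unit \<open>\<eta>\<close> and counit \<open>\<epsilon>\<close>.\<close>

locale adjunction =
  left: is_functor S T L + right: is_functor T S R +
  unit: nat_trans S S id_fctor "comp_fctor R L" \<eta> +
  counit: nat_trans T T "comp_fctor L R" id_fctor \<epsilon>
  for S :: "('o, 'm, 'z) category_scheme" and T :: "('p, 'n, 'w) category_scheme"
    and L :: "('o, 'm, 'p, 'n) fctor" and R :: "('p, 'n, 'o, 'm) fctor"
    and \<eta> :: "'o \<Rightarrow> 'm" and \<epsilon> :: "'p \<Rightarrow> 'n" +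
  assumes triangle_L: "A \<in> Obj S \<Longrightarrow>
      \<epsilon> (OMap L A) \<cdot>\<^bsub>T\<^esub> AMap L (\<eta> A) = Id T (OMap L A)"
    and triangle_R: "B \<in> Obj T \<Longrightarrow>
      AMap R (\<epsilon> B) \<cdot>\<^bsub>S\<^esub> \<eta> (OMap R B) = Id S (OMap R B)"

record ('o, 'm) preadditive_category = "('o, 'm) category" +
  Add :: "'m \<Rightarrow> 'm \<Rightarrow> 'm"
  Zero :: "'o \<Rightarrow> 'o \<Rightarrow> 'm"

text \<open>The additive group \<open>Hom(A, B)\<close>, written as a (multiplicative) \<^const>\<open>comm_group\<close>;
  so \<^const>\<open>finprod\<close> in this group is the finite sum of morphisms.\<close>

definition hom_group ::
  "('o, 'm, 'z) preadditive_category_scheme \<Rightarrow> 'o \<Rightarrow> 'o \<Rightarrow> 'm monoid"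
  where "hom_group C A B = \<lparr>carrier = Hom C A B, mult = Add C, one = Zero C A B\<rparr>"

locale preadditive_category = category C
  for C :: "('o, 'm, 'z) preadditive_category_scheme" (structure) +
  assumes hom_comm_group: "A \<in> Obj C \<Longrightarrow> B \<in> Obj C \<Longrightarrow> comm_group (hom_group C A B)"
    and Comp_Add: "f \<in> Hom C A B \<Longrightarrow> f' \<in> Hom C A B \<Longrightarrow> g \<in> Hom C B D \<Longrightarrow>
      g \<cdot> Add C f f' = Add C (g \<cdot> f) (g \<cdot> f')"
    and Add_Comp: "f \<in> Hom C A B \<Longrightarrow> g \<in> Hom C B D \<Longrightarrow> g' \<in> Hom C B D \<Longrightarrow>
      Add C g g' \<cdot> f = Add C (g \<cdot> f) (g' \<cdot> f)"

text \<open>\<open>X\<close> is a direct sum (biproduct) of \<open>Y 0, \<dots>, Y (n - 1)\<close>; for \<open>n = 0\<close> this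
  says that \<open>Id C X\<close> is zero, i.e. that \<open>X\<close> is a zero object.\<close>

definition is_direct_sum ::
  "('o, 'm, 'z) preadditive_category_scheme \<Rightarrow> nat \<Rightarrow> (nat \<Rightarrow> 'o) \<Rightarrow> 'o \<Rightarrow> bool"
  where "is_direct_sum C n Y X \<longleftrightarrow> X \<in> Obj C \<and> (\<forall>k<n. Y k \<in> Obj C) \<and>
    (\<exists>\<iota> \<pi>. (\<forall>k<n. \<iota> k \<in> Hom C (Y k) X \<and> \<pi> k \<in> Hom C X (Y k)) \<and>
      (\<forall>j<n. \<forall>k<n. \<pi> j \<cdot>\<^bsub>C\<^esub> \<iota> k = (if j = k then Id C (Y k) else Zero C (Y k) (Y j))) \<and>
      (\<Otimes>\<^bsub>hom_group C X X\<^esub>k\<in>{..<n}. \<iota> k \<cdot>\<^bsub>C\<^esub> \<pi> k) = Id C X)"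

locale additive_category = preadditive_category +
  assumes ex_direct_sum: "(\<forall>k<n. Y k \<in> Obj C) \<Longrightarrow> \<exists>X. is_direct_sum C n Y X"

text \<open>The objects of \<open>add(A)\<close>: the smallest class of objects that contains \<open>A\<close> and is
  closed under finite direct sums and retracts. The subcategory is full, so it is
  determined by its objects.\<close>

inductive_set add_closure :: "('o, 'm, 'z) preadditive_category_scheme \<Rightarrow> 'o \<Rightarrow> 'o set"
  for C :: "('o, 'm, 'z) preadditive_category_scheme" and A :: 'o
  where
    base: "A \<in> Obj C \<Longrightarrow> A \<in> add_closure C A"
  | direct_sum: "(\<forall>k<n. Y k \<in> add_closure C A) \<Longrightarrow> is_direct_sum C n Y X \<Longrightarrow> X \<in> add_closure C A"
  | retract: "X \<in> add_closure C A \<Longrightarrow> is_retract C B X \<Longrightarrow> B \<in> add_closure C A"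

end

theory Submission
  imports Defs
begin

text \<open>For any natural transformation \<open>\<tau> : 1 \<rightarrow> F\<close>, whether or not \<open>F\<close> is additive, the
  objects \<open>X\<close> for which \<open>\<tau> X\<close> has a left inverse are closed under retracts and finite direct
  sums: if \<open>g k\<close> is a left inverse of \<open>\<tau> (Y k)\<close>, then naturality makes
  \<open>\<Sum>k. \<iota> k \<cdot> g k \<cdot> F (\<pi> k)\<close> a left inverse of \<open>\<tau> X\<close>.
  For the unit, the triangle identity gives the left inverse \<open>R (\<epsilon> N)\<close> at \<open>R N\<close>.
  Part (2) is dual.\<close>

text \<open>Meant for composition with a fixed morphism, which is a homomorphism between Hom groups.
  The empty sum is included: a group homomorphism preserves the neutral element, so composing with a
  zero morphism gives zero without an axiom of its own.\<close>

lemma hom_finprod: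
  assumes "comm_group G" and "comm_group H" and "h \<in> hom G H"
    and "finite A" and "f \<in> A \<rightarrow> carrier G"
  shows "h (finprod G f A) = finprod H (\<lambda>k. h (f k)) A"
proof -
  interpret G: comm_group G by fact
  interpret H: comm_group H by fact
  interpret group_hom G H h
    using assms(3) by unfold_locales
  show ?thesis
    using assms(4,5) by induction (simp_all add: Pi_iff)
qed

lemma (in category) HomD:
  assumes "f \<in> Hom C A B"
  shows "A \<in> Obj C" and "B \<in> Obj C"
  using assms Dom_in_Obj[of f] Cod_in_Obj[of f] by (auto simp: Hom_def)

lemma split_mono_iff:
  assumes "f \<in> Hom C A B"
  shows "split_mono C f \<longleftrightarrow> (\<exists>g \<in> Hom C B A. g \<cdot>\<^bsub>C\<^esub> f = Id C A)"
  using assms by (auto simp: split_mono_def Hom_def)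

lemma split_epi_iff:
  assumes "f \<in> Hom C A B"
  shows "split_epi C f \<longleftrightarrow> (\<exists>g \<in> Hom C B A. f \<cdot>\<^bsub>C\<^esub> g = Id C B)"
  using assms by (auto simp: split_epi_def Hom_def)

context preadditive_category
begin

lemma carrier_hom_group: "carrier (hom_group C A B) = Hom C A B"
  by (simp add: hom_group_def)

lemma finsum_in_Hom:
  assumes "A \<in> Obj C" and "B \<in> Obj C" and "\<And>k. k \<in> K \<Longrightarrow> f k \<in> Hom C A B"
  shows "(\<Otimes>\<^bsub>hom_group C A B\<^esub>k\<in>K. f k) \<in> Hom C A B"
proof -
  interpret comm_group "hom_group C A B"
    using assms by (intro hom_comm_group)
  show ?thesis
    using finprod_closed[of f K] assms(3) by (auto simp: carrier_hom_group)
qed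

text \<open>By \<open>Comp_Add\<close>, composing with \<open>g\<close> on the left is a group
  homomorphism, so it passes through the sum. The object \<open>A\<close> has to be assumed
  separately because an empty \<open>K\<close> supplies no morphism out of it.\<close>

lemma Comp_finsum:
  assumes "A \<in> Obj C" and "g \<in> Hom C B D" and "finite K" and "\<And>k. k \<in> K \<Longrightarrow> f k \<in> Hom C A B"
  shows "g \<cdot> (\<Otimes>\<^bsub>hom_group C A B\<^esub>k\<in>K. f k) = (\<Otimes>\<^bsub>hom_group C A D\<^esub>k\<in>K. g \<cdot> f k)"
proof (rule hom_finprod)
  show "(\<lambda>f. g \<cdot> f) \<in> hom (hom_group C A B) (hom_group C A D)"
    using assms(2) by (auto simp: hom_def hom_group_def Comp_in_Hom Comp_Add)
qed (use assms HomD[OF assms(2)] in \<open>auto simp: hom_comm_group carrier_hom_group\<close>)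

lemma finsum_Comp:
  assumes "D \<in> Obj C" and "f \<in> Hom C A B" and "finite K" and "\<And>k. k \<in> K \<Longrightarrow> g k \<in> Hom C B D"
  shows "(\<Otimes>\<^bsub>hom_group C B D\<^esub>k\<in>K. g k) \<cdot> f = (\<Otimes>\<^bsub>hom_group C A D\<^esub>k\<in>K. g k \<cdot> f)"
proof (rule hom_finprod)
  show "(\<lambda>g. g \<cdot> f) \<in> hom (hom_group C B D) (hom_group C A D)"
    using assms(2) by (auto simp: hom_def hom_group_def Comp_in_Hom Add_Comp)
qed (use assms HomD[OF assms(2)] in \<open>auto simp: hom_comm_group carrier_hom_group\<close>)

lemma finsum_cong:
  assumes "A \<in> Obj C" and "B \<in> Obj C"
    and "\<And>k. k \<in> K \<Longrightarrow> f k = g k" and "\<And>k. k \<in> K \<Longrightarrow> g k \<in> Hom C A B"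
  shows "(\<Otimes>\<^bsub>hom_group C A B\<^esub>k\<in>K. f k) = (\<Otimes>\<^bsub>hom_group C A B\<^esub>k\<in>K. g k)"
proof -
  interpret comm_group "hom_group C A B"
    using assms by (intro hom_comm_group)
  show ?thesis
    using assms(3,4) by (intro finprod_cong') (auto simp: carrier_hom_group)
qed

text \<open>Induction on membership in \<open>add_closure\<close>. Additivity of \<open>F\<close>
  can be avoided because \<open>F\<close> is applied only to single morphisms: the sum is formed in
  \<open>Hom C (OMap F X) X\<close>, after each term has left the image of \<open>F\<close>.\<close>

lemma split_mono_add_closure:
  assumes "nat_trans C C id_fctor F \<tau>" and "split_mono C (\<tau> A)" and "X \<in> add_closure C A"
  shows "split_mono C (\<tau> X)"
  using assms(3)
proof induction
  interpret nat_trans C C id_fctor F \<tau> by fact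
  have comp: "\<tau> X \<in> Hom C X (OMap F X)" if "X \<in> Obj C" for X
    using component[OF that] by (simp add: id_fctor_def)
  have nat: "\<tau> Y \<cdot> f = AMap F f \<cdot> \<tau> X" if "f \<in> Hom C X Y" for f X Y
    using naturality[OF that] by (simp add: id_fctor_def)
  {
    case base
    show ?case by fact
  next
    case (direct_sum n Y X)
    from \<open>is_direct_sum C n Y X\<close> obtain \<iota> \<pi>
      where X: "X \<in> Obj C" and Y: "\<And>k. k < n \<Longrightarrow> Y k \<in> Obj C"
        and \<iota>: "\<And>k. k < n \<Longrightarrow> \<iota> k \<in> Hom C (Y k) X"
        and \<pi>: "\<And>k. k < n \<Longrightarrow> \<pi> k \<in> Hom C X (Y k)"
        and sum: "(\<Otimes>\<^bsub>hom_group C X X\<^esub>k\<in>{..<n}. \<iota> k \<cdot> \<pi> k) = Id C X"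
      unfolding is_direct_sum_def by blast
    have "\<exists>g \<in> Hom C (OMap F (Y k)) (Y k). g \<cdot> \<tau> (Y k) = Id C (Y k)" if "k < n" for k
      using direct_sum.IH that split_mono_iff[OF comp[OF Y[OF that]]] by simp
    then obtain g where g: "\<And>k. k < n \<Longrightarrow> g k \<in> Hom C (OMap F (Y k)) (Y k)"
      and g_inv: "\<And>k. k < n \<Longrightarrow> g k \<cdot> \<tau> (Y k) = Id C (Y k)"
      by metis
    have F\<pi>: "AMap F (\<pi> k) \<in> Hom C (OMap F X) (OMap F (Y k))" if "k < n" for k
      using tgt.AMap_in_Hom[OF \<pi>[OF that]] .
    have g\<pi>: "g k \<cdot> AMap F (\<pi> k) \<in> Hom C (OMap F X) (Y k)" if "k < n" for k
      using Comp_in_Hom[OF F\<pi> g] that by blast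
    \<comment> \<open>The path from \<open>F X\<close> through \<open>F (Y k)\<close> and
      \<open>Y k\<close> to \<open>X\<close>.\<close>
    define r where "r k = \<iota> k \<cdot> (g k \<cdot> AMap F (\<pi> k))" for k
    have r: "r k \<in> Hom C (OMap F X) X" if "k < n" for k
      unfolding r_def using Comp_in_Hom[OF g\<pi> \<iota>] that by blast
    have FX: "OMap F X \<in> Obj C"
      using HomD[OF comp[OF X]] by blast
    have r_\<tau>: "r k \<cdot> \<tau> X = \<iota> k \<cdot> \<pi> k" if k: "k < n" for k
    proof -
      have "r k \<cdot> \<tau> X = \<iota> k \<cdot> (g k \<cdot> (AMap F (\<pi> k) \<cdot> \<tau> X))"
        unfolding r_def
        using Comp_assoc[OF comp[OF X] g\<pi> \<iota>] Comp_assoc[OF comp[OF X] F\<pi> g] k by simp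
      \<comment> \<open>Naturality at \<open>\<pi> k\<close> trades \<open>\<tau> X\<close> for
        \<open>\<tau> (Y k)\<close>, which \<open>g k\<close> cancels.\<close>
      also have "\<dots> = \<iota> k \<cdot> (g k \<cdot> \<tau> (Y k) \<cdot> \<pi> k)"
        using nat[OF \<pi>] Comp_assoc[OF \<pi> comp[OF Y] g] k by simp
      finally show ?thesis
        using g_inv Id_Comp[OF \<pi>] k by simp
    qed
    \<comment> \<open>For \<open>n = 0\<close> this is the zero morphism, which still works since
      \<open>sum\<close> then says that the identity of \<open>X\<close> is zero.\<close>
    let ?r = "\<Otimes>\<^bsub>hom_group C (OMap F X) X\<^esub>k\<in>{..<n}. r k"
    have "?r \<cdot> \<tau> X = (\<Otimes>\<^bsub>hom_group C X X\<^esub>k\<in>{..<n}. r k \<cdot> \<tau> X)"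
      using r by (subst finsum_Comp[OF X comp[OF X]]) simp_all
    also have "\<dots> = (\<Otimes>\<^bsub>hom_group C X X\<^esub>k\<in>{..<n}. \<iota> k \<cdot> \<pi> k)"
      using r_\<tau> by (intro finsum_cong X) (simp_all add: Comp_in_Hom[OF \<pi> \<iota>])
    finally have "?r \<cdot> \<tau> X = Id C X"
      using sum by simp
    moreover have "?r \<in> Hom C (OMap F X) X"
      using r by (intro finsum_in_Hom FX X) simp
    ultimately show ?case
      using split_mono_iff[OF comp[OF X]] by blast
  next
    case (retract X B)
    then obtain i p where X: "X \<in> Obj C" and B: "B \<in> Obj C"
      and i: "i \<in> Hom C B X" and p: "p \<in> Hom C X B" and p_i: "p \<cdot> i = Id C B"
      unfolding is_retract_def by blast
    from retract obtain g where g: "g \<in> Hom C (OMap F X) X" and g_inv: "g \<cdot> \<tau> X = Id C X"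
      using split_mono_iff[OF comp[OF X]] by blast
    note Fi = tgt.AMap_in_Hom[OF i]
    note gi = Comp_in_Hom[OF Fi g]
    \<comment> \<open>The left inverse of \<open>\<tau> B\<close> goes up to \<open>F X\<close>
      along \<open>F i\<close>, back by \<open>g\<close>, and down along \<open>p\<close>;
      naturality at \<open>i\<close> reduces it to \<open>p \<cdot> i\<close>.\<close>
    have "p \<cdot> (g \<cdot> AMap F i) \<cdot> \<tau> B = p \<cdot> (g \<cdot> (AMap F i \<cdot> \<tau> B))"
      using Comp_assoc[OF comp[OF B] gi p] Comp_assoc[OF comp[OF B] Fi g] by simp
    also have "\<dots> = p \<cdot> (g \<cdot> \<tau> X \<cdot> i)"
      using nat[OF i] Comp_assoc[OF i comp[OF X] g] by simp
    also have "\<dots> = Id C B"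
      using g_inv Id_Comp[OF i] p_i by simp
    finally show ?case
      using split_mono_iff[OF comp[OF B]] Comp_in_Hom[OF gi p] by blast
  }
qed

text \<open>The previous argument with arrows reversed. Naturality is now used at the inclusions
  \<open>\<iota> k\<close> and at the retraction \<open>p\<close>, so these are the morphisms to
  which \<open>F\<close> is applied.\<close>

lemma split_epi_add_closure:
  assumes "nat_trans C C F id_fctor \<tau>" and "split_epi C (\<tau> A)" and "X \<in> add_closure C A"
  shows "split_epi C (\<tau> X)"
  using assms(3)
proof induction
  interpret nat_trans C C F id_fctor \<tau> by fact
  have comp: "\<tau> X \<in> Hom C (OMap F X) X" if "X \<in> Obj C" for X
    using component[OF that] by (simp add: id_fctor_def)
  have nat: "\<tau> Y \<cdot> AMap F f = f \<cdot> \<tau> X" if "f \<in> Hom C X Y" for f X Y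
    using naturality[OF that] by (simp add: id_fctor_def)
  {
    case base
    show ?case by fact
  next
    case (direct_sum n Y X)
    from \<open>is_direct_sum C n Y X\<close> obtain \<iota> \<pi>
      where X: "X \<in> Obj C" and Y: "\<And>k. k < n \<Longrightarrow> Y k \<in> Obj C"
        and \<iota>: "\<And>k. k < n \<Longrightarrow> \<iota> k \<in> Hom C (Y k) X"
        and \<pi>: "\<And>k. k < n \<Longrightarrow> \<pi> k \<in> Hom C X (Y k)"
        and sum: "(\<Otimes>\<^bsub>hom_group C X X\<^esub>k\<in>{..<n}. \<iota> k \<cdot> \<pi> k) = Id C X"
      unfolding is_direct_sum_def by blast
    have "\<exists>g \<in> Hom C (Y k) (OMap F (Y k)). \<tau> (Y k) \<cdot> g = Id C (Y k)" if "k < n" for k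
      using direct_sum.IH that split_epi_iff[OF comp[OF Y[OF that]]] by simp
    then obtain g where g: "\<And>k. k < n \<Longrightarrow> g k \<in> Hom C (Y k) (OMap F (Y k))"
      and g_inv: "\<And>k. k < n \<Longrightarrow> \<tau> (Y k) \<cdot> g k = Id C (Y k)"
      by metis
    have F\<iota>: "AMap F (\<iota> k) \<in> Hom C (OMap F (Y k)) (OMap F X)" if "k < n" for k
      using src.AMap_in_Hom[OF \<iota>[OF that]] .
    have g\<pi>: "g k \<cdot> \<pi> k \<in> Hom C X (OMap F (Y k))" if "k < n" for k
      using Comp_in_Hom[OF \<pi> g] that by blast
    \<comment> \<open>The path from \<open>X\<close> through \<open>Y k\<close> and
      \<open>F (Y k)\<close> to \<open>F X\<close>.\<close>
    define s where "s k = AMap F (\<iota> k) \<cdot> (g k \<cdot> \<pi> k)" for k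
    have s: "s k \<in> Hom C X (OMap F X)" if "k < n" for k
      unfolding s_def using Comp_in_Hom[OF g\<pi> F\<iota>] that by blast
    have FX: "OMap F X \<in> Obj C"
      using HomD[OF comp[OF X]] by blast
    have \<tau>_s: "\<tau> X \<cdot> s k = \<iota> k \<cdot> \<pi> k" if k: "k < n" for k
    proof -
      have "\<tau> X \<cdot> s k = \<tau> X \<cdot> AMap F (\<iota> k) \<cdot> (g k \<cdot> \<pi> k)"
        unfolding s_def using Comp_assoc[OF g\<pi> F\<iota> comp[OF X]] k by simp
      \<comment> \<open>Naturality at \<open>\<iota> k\<close> moves \<open>\<tau>\<close> to
        \<open>Y k\<close>, where \<open>g k\<close> is a right inverse.\<close>
      also have "\<dots> = \<iota> k \<cdot> (\<tau> (Y k) \<cdot> g k \<cdot> \<pi> k)"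
        using nat[OF \<iota>] Comp_assoc[OF g\<pi> comp[OF Y] \<iota>] Comp_assoc[OF \<pi> g comp[OF Y]] k by simp
      finally show ?thesis
        using g_inv Id_Comp[OF \<pi>] k by simp
    qed
    let ?s = "\<Otimes>\<^bsub>hom_group C X (OMap F X)\<^esub>k\<in>{..<n}. s k"
    have "\<tau> X \<cdot> ?s = (\<Otimes>\<^bsub>hom_group C X X\<^esub>k\<in>{..<n}. \<tau> X \<cdot> s k)"
      using s by (subst Comp_finsum[OF X comp[OF X]]) simp_all
    also have "\<dots> = (\<Otimes>\<^bsub>hom_group C X X\<^esub>k\<in>{..<n}. \<iota> k \<cdot> \<pi> k)"
      using \<tau>_s by (intro finsum_cong X) (simp_all add: Comp_in_Hom[OF \<pi> \<iota>])
    finally have "\<tau> X \<cdot> ?s = Id C X"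
      using sum by simp
    moreover have "?s \<in> Hom C X (OMap F X)"
      using s by (intro finsum_in_Hom FX X) simp
    ultimately show ?case
      using split_epi_iff[OF comp[OF X]] by blast
  next
    case (retract X B)
    then obtain i p where X: "X \<in> Obj C" and B: "B \<in> Obj C"
      and i: "i \<in> Hom C B X" and p: "p \<in> Hom C X B" and p_i: "p \<cdot> i = Id C B"
      unfolding is_retract_def by blast
    from retract obtain g where g: "g \<in> Hom C X (OMap F X)" and g_inv: "\<tau> X \<cdot> g = Id C X"
      using split_epi_iff[OF comp[OF X]] by blast
    note Fp = src.AMap_in_Hom[OF p]
    note gi = Comp_in_Hom[OF i g]
    \<comment> \<open>The right inverse of \<open>\<tau> B\<close> runs along \<open>i\<close>, then
      \<open>g\<close>, then \<open>F p\<close>; naturality at \<open>p\<close> leaves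
      \<open>p \<cdot> i\<close>.\<close>
    have "\<tau> B \<cdot> (AMap F p \<cdot> (g \<cdot> i)) = \<tau> B \<cdot> AMap F p \<cdot> (g \<cdot> i)"
      using Comp_assoc[OF gi Fp comp[OF B]] by simp
    also have "\<dots> = p \<cdot> (\<tau> X \<cdot> g \<cdot> i)"
      using nat[OF p] Comp_assoc[OF gi comp[OF X] p] Comp_assoc[OF i g comp[OF X]] by simp
    also have "\<dots> = Id C B"
      using g_inv Id_Comp[OF i] p_i by simp
    finally show ?case
      using split_epi_iff[OF comp[OF B]] Comp_in_Hom[OF gi Fp] by blast
  }
qed

end

context adjunction
begin

lemma split_mono_unit:
  assumes "N \<in> Obj T"
  shows "split_mono S (\<eta> (OMap R N))"
proof -
  have \<eta>: "\<eta> (OMap R N) \<in> Hom S (OMap R N) (OMap R (OMap L (OMap R N)))"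
    using unit.component[OF right.OMap_in_Obj[OF assms]] by (simp add: id_fctor_def comp_fctor_def)
  have "AMap R (\<epsilon> N) \<in> Hom S (OMap R (OMap L (OMap R N))) (OMap R N)"
    using right.AMap_in_Hom[OF counit.component[OF assms]]
    by (simp add: id_fctor_def comp_fctor_def)
  then show ?thesis
    using triangle_R[OF assms] split_mono_iff[OF \<eta>] by blast
qed

text \<open>The other triangle identity makes \<open>L (\<eta> M)\<close> a right inverse.\<close>

lemma split_epi_counit:
  assumes "M \<in> Obj S"
  shows "split_epi T (\<epsilon> (OMap L M))"
proof -
  have \<epsilon>: "\<epsilon> (OMap L M) \<in> Hom T (OMap L (OMap R (OMap L M))) (OMap L M)"
    using counit.component[OF left.OMap_in_Obj[OF assms]] by (simp add: id_fctor_def comp_fctor_def)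
  have "AMap L (\<eta> M) \<in> Hom T (OMap L M) (OMap L (OMap R (OMap L M)))"
    using left.AMap_in_Hom[OF unit.component[OF assms]]
    by (simp add: id_fctor_def comp_fctor_def)
  then show ?thesis
    using triangle_L[OF assms] split_epi_iff[OF \<epsilon>] by blast
qed

end

theorem lemma3p1:
  fixes S :: "('o, 'm, 'z) preadditive_category_scheme"
    and T :: "('p, 'n, 'w) preadditive_category_scheme"
    and L :: "('o, 'm, 'p, 'n) fctor" and R :: "('p, 'n, 'o, 'm) fctor"
    and \<eta> :: "'o \<Rightarrow> 'm" and \<epsilon> :: "'p \<Rightarrow> 'n"
  assumes "additive_category S" and "additive_category T"
    and "adjunction S T L R \<eta> \<epsilon>"
  shows "(\<forall>M \<in> Obj S. \<forall>N \<in> Obj T. M \<in> add_closure S (OMap R N) \<longrightarrow> split_mono S (\<eta> M)) \<and>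
    (\<forall>M \<in> Obj S. \<forall>N \<in> Obj T. N \<in> add_closure T (OMap L M) \<longrightarrow> split_epi T (\<epsilon> N))"
proof -
  interpret S: additive_category S by fact
  interpret T: additive_category T by fact
  interpret adjunction S T L R \<eta> \<epsilon> by fact
  show ?thesis
    \<comment> \<open>The closure lemmas are used in \<open>S\<close> for the endofunctor
      \<open>RL\<close> starting from \<open>R N\<close>, and in \<open>T\<close> for
      \<open>LR\<close> starting from \<open>L M\<close>. The triangle identities enter only through
      these starting objects.\<close>
    using S.split_mono_add_closure[OF unit.nat_trans_axioms split_mono_unit]
      T.split_epi_add_closure[OF counit.nat_trans_axioms split_epi_counit]
    by blast
qed

end
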